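(* For every integer $n\ge 4$, there exists an acyclic digraph $H$ on $n$ vertices with maximum degree $3$ for which $$\overrightarrow{r_k}(H)\ \ge\ n^{\log n/(20\log\log n)}$$ for all $k\ge 2$.
   Context: All digraphs are finite, simple and oriented (no loops, parallel or anti-parallel edges). The maximum degree of $H$ is $\max_{v}(|N^+(v)|+|N^-(v)|)$. A copy of $H$ in $T$ is given by an injective map $V(H)\to V(T)$ sending edges of $H$ to edges of $T$ with orientations preserved. For an acyclic digraph $H$ and $k\ge1$, $\overrightarrow{r_k}(H)$ is the least $N$ such that every tournament on $N$ vertices whose edges are colored with $k$ colors contains a monochromatic copy of $H$. All logarithms are to base $2$. *)

theory Defs
  imports Complex_Main "Graph_Theory.Pair_Digraph"
begin

text \<open>
  \<^locale>\<open>pair_digraph\<close> is finite and loop-free, and its arcs are a set of pairs of vertices, so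
  it has no parallel arcs. It does not by itself exclude anti-parallel arcs.
\<close>

locale oriented_digraph = pair_digraph G for G :: "'a pair_pre_digraph" +
  assumes no_antiparallel: "(u, v) \<in> parcs G \<Longrightarrow> (v, u) \<notin> parcs G"

locale tournament = oriented_digraph G for G :: "'a pair_pre_digraph" +
  assumes complete:
    "\<lbrakk>u \<in> pverts G; v \<in> pverts G; u \<noteq> v\<rbrakk> \<Longrightarrow> (u, v) \<in> parcs G \<or> (v, u) \<in> parcs G"

definition out_nbrs :: "'a pair_pre_digraph \<Rightarrow> 'a \<Rightarrow> 'a set" where
  "out_nbrs H v = {w. (v, w) \<in> parcs H}"

definition in_nbrs :: "'a pair_pre_digraph \<Rightarrow> 'a \<Rightarrow> 'a set" where
  "in_nbrs H v = {u. (u, v) \<in> parcs H}"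

definition max_degree :: "'a pair_pre_digraph \<Rightarrow> nat" where
  "max_degree H = Max ((\<lambda>v. card (out_nbrs H v) + card (in_nbrs H v)) ` pverts H)"

definition digraph_copy ::
    "'a pair_pre_digraph \<Rightarrow> 'b pair_pre_digraph \<Rightarrow> ('a \<Rightarrow> 'b) \<Rightarrow> bool" where
  "digraph_copy H T f \<longleftrightarrow>
     inj_on f (pverts H) \<and> f ` pverts H \<subseteq> pverts T \<and>
     (\<forall>(u, v) \<in> parcs H. (f u, f v) \<in> parcs T)"

definition monochromatic_copy ::
    "'a pair_pre_digraph \<Rightarrow> 'b pair_pre_digraph \<Rightarrow> ('b \<times> 'b \<Rightarrow> nat) \<Rightarrow> ('a \<Rightarrow> 'b) \<Rightarrow> bool" where
  "monochromatic_copy H T c f \<longleftrightarrow>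
     digraph_copy H T f \<and> (\<exists>i. \<forall>(u, v) \<in> parcs H. c (f u, f v) = i)"

text \<open>
  Since tournaments are finite, taking their vertices to be natural numbers loses no generality.
  By Ramsey's theorem such an \<open>N\<close> exists whenever \<open>H\<close> is finite and acyclic and \<open>k \<ge> 1\<close>; outside
  that case the value of \<open>oriented_ramsey\<close> carries no meaning.
\<close>

definition oriented_ramsey :: "nat \<Rightarrow> 'a pair_pre_digraph \<Rightarrow> nat" where
  "oriented_ramsey k H =
     (LEAST N. \<forall>(T :: nat pair_pre_digraph) c.
        tournament T \<and> card (pverts T) = N \<and> c ` parcs T \<subseteq> {..<k} \<longrightarrow>
        (\<exists>f. monochromatic_copy H T c f))"

end

theory Submission
  imports Defs "HOL-Library.Ramsey"
begin

text \<open>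
  Let \<open>H\<close> be a directed Hamiltonian path on \<open>{..<n}\<close> together with the matching
  \<open>a * q + c \<mapsto> c * q + a\<close> (\<open>a < c < q\<close>), where \<open>q\<close> is about \<open>sqrt n\<close>. The path forces every copy
  of \<open>H\<close> in a transitive tournament to be increasing, and the matching joins any two of the \<open>q\<close>
  consecutive blocks of length \<open>q\<close>.

  Colour the transitive tournament on \<open>N * K\<close> vertices lexicographically: on top a colouring of \<open>N\<close>
  points without a monochromatic \<open>s\<close>-clique, below a colouring of \<open>K\<close> points that avoids every run
  of \<open>m\<close> consecutive blocks. In a monochromatic copy of \<open>N + s * m\<close> blocks, at most \<open>N\<close> blocks are
  broken between top-level points; the remaining ones either spread over \<open>s\<close> top-level points,
  which then form a monochromatic clique, or put \<open>m\<close> of them above a single point. Erdos' counting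
  bound permits \<open>s\<close> of order \<open>log n\<close>, and iterating with \<open>N = s * m\<close> multiplies \<open>m\<close> by \<open>2 * s\<close> in each
  of about \<open>log q / log (2 * s)\<close> rounds, so that the logarithm of the number of vertices reaches about
  \<open>(log n)^2 / (8 * log (2 * s))\<close>. For \<open>n < 2 ^ 16\<close> the claimed bound is at most \<open>n\<close>.
\<close>

section \<open>Lower bounds from transitive tournaments\<close>

lemma nsets2_lessE:
  fixes A :: "'a :: linorder set"
  assumes "X \<in> [A]\<^bsup>2\<^esup>"
  obtains x y where "X = {x, y}" "x \<in> A" "y \<in> A" "x < y"
proof -
  obtain x y where "X = {x, y}" "x \<in> A" "y \<in> A" "x \<noteq> y"
    using nsets2_E[OF assms] .
  then show ?thesis
    using that[of x y] that[of y x] by (cases "x < y") (auto simp: insert_commute)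
qed

definition transitive_tournament :: "nat \<Rightarrow> nat pair_pre_digraph" where
  "transitive_tournament N = \<lparr>pverts = {..<N}, parcs = {(u, v). u < v \<and> v < N}\<rparr>"

lemma tournament_transitive_tournament: "tournament (transitive_tournament N)"
proof -
  have "{(u, v). u < v \<and> v < N} \<subseteq> {..<N} \<times> {..<N}"
    by auto
  then have "finite {(u, v). u < v \<and> v < N}"
    by (rule finite_subset) simp
  then show ?thesis
    by unfold_locales (auto simp: transitive_tournament_def)
qed

text \<open>Ramsey's theorem is applied with \<open>2 * k\<close> colours: besides its colour under
  \<open>c\<close>, a pair records whether its arc agrees with a fixed enumeration \<open>e\<close>
  of the vertices. A homogeneous set is then transitive as well as monochromatic.\<close>

lemma monochromatic_transitive_subtournament:
  assumes N: "partn_lst {..<N} (replicate (2 * k) n) 2"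
    and T: "tournament T" and card_T: "card (pverts T) = N" and c: "c ` parcs T \<subseteq> {..<k}"
  shows "\<exists>f i. f \<in> {..<n} \<rightarrow> pverts T \<and>
           (\<forall>x y. x < y \<longrightarrow> y < n \<longrightarrow> (f x, f y) \<in> parcs T \<and> c (f x, f y) = i)"
proof -
  interpret tournament T by (rule T)
  obtain e where e: "bij_betw e {..<N} (pverts T)"
    using ex_bij_betw_nat_finite[OF pair_finite_verts] card_T by (auto simp: atLeast0LessThan)
  have e_verts: "e x \<in> pverts T" if "x < N" for x
    using bij_betwE[OF e] that by auto
  define F where "F X = (let u = e (Min X); v = e (Max X) in
     if (u, v) \<in> parcs T then c (u, v) else k + c (v, u))" for X
  have F: "F {x, y} = (if (e x, e y) \<in> parcs T then c (e x, e y) else k + c (e y, e x))"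
    if "x < y" for x y
    using that by (simp add: F_def Let_def)
  have arc: "(e x, e y) \<in> parcs T \<or> (e y, e x) \<in> parcs T" if "x < y" "y < N" for x y
  proof (rule complete)
    show "e x \<in> pverts T" "e y \<in> pverts T" using e_verts that by auto
    show "e x \<noteq> e y"
      using that bij_betw_imp_inj_on[OF e] by (auto simp: inj_on_def)
  qed
  have c_less: "c a < k" if "a \<in> parcs T" for a
    using c that by auto
  have "F \<in> [{..<N}]\<^bsup>2\<^esup> \<rightarrow> {..<2 * k}"
  proof
    fix X assume "X \<in> [{..<N}]\<^bsup>2\<^esup>"
    then obtain x y where "X = {x, y}" "x \<in> {..<N}" "y \<in> {..<N}" "x < y"
      by (rule nsets2_lessE)
    then show "F X \<in> {..<2 * k}"
      using arc[of x y] by (auto simp: F dest: c_less)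
  qed
  then obtain i X where i: "i < 2 * k" and X: "X \<in> [{..<N}]\<^bsup>n\<^esup>" and FX: "F ` [X]\<^bsup>2\<^esup> \<subseteq> {i}"
    using N by (auto simp: partn_lst_def monochromatic_def dest!: bspec[of _ _ F])
  obtain h where h: "bij_betw h {..<n} X" "strict_mono_on {..<n} h"
    using X ex_bij_betw_strict_mono_card[of X] by (auto simp: nsets_def)
  have h_mono: "h x < h y" if "x < y" "y < n" for x y
    using h(2) that by (auto simp: strict_mono_on_def)
  have h_X: "h x \<in> X" "h x < N" if "x < n" for x
    using bij_betwE[OF h(1)] X that by (auto simp: nsets_def)
  have Fh: "F {h x, h y} = i" if "x < y" "y < n" for x y
  proof -
    have "{h x, h y} \<in> [X]\<^bsup>2\<^esup>"
      using h_mono[OF that] h_X(1)[of x] h_X(1)[of y] that by simp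
    then show ?thesis using FX by blast
  qed
  show ?thesis
  proof (cases "i < k")
    case True
    have "(e (h x), e (h y)) \<in> parcs T \<and> c (e (h x), e (h y)) = i" if "x < y" "y < n" for x y
      using Fh[OF that] True F[OF h_mono[OF that]] by (auto split: if_splits)
    moreover have "e \<circ> h \<in> {..<n} \<rightarrow> pverts T"
      using e_verts h_X by auto
    ultimately show ?thesis
      by (intro exI[of _ "e \<circ> h"] exI[of _ i]) auto
  next
    case False
    \<comment> \<open>Here all arcs run against the enumeration, so the homogeneous set is listed in
      reverse.\<close>
    define g where "g x = e (h (n - Suc x))" for x
    have "(g x, g y) \<in> parcs T \<and> c (g x, g y) = i - k" if "x < y" "y < n" for x y
    proof -
      have lt: "n - Suc y < n - Suc x" "n - Suc x < n"
        using that by auto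
      have "(g y, g x) \<notin> parcs T"
        using Fh[OF lt] F[OF h_mono[OF lt]] False c_less[of "(g y, g x)"] by (auto simp: g_def)
      then show ?thesis
        using Fh[OF lt] F[OF h_mono[OF lt]] arc[OF h_mono[OF lt]] h_X(2)[OF lt(2)]
        by (auto simp: g_def)
    qed
    moreover have "g \<in> {..<n} \<rightarrow> pverts T"
      using e_verts h_X by (auto simp: g_def)
    ultimately show ?thesis by blast
  qed
qed

text \<open>The finite Ramsey theorem is needed here because a \<open>LEAST\<close> over an empty set of candidates is
  unspecified.\<close>

lemma le_oriented_ramsey:
  fixes H :: "nat pair_pre_digraph"
  assumes verts: "pverts H = {..<n}" and arcs: "parcs H \<subseteq> {(u, v). u < v \<and> v < n}"
    and c: "\<And>u v. c (u, v) < k"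
    and avoid: "\<And>N f. N < M \<Longrightarrow> \<not> monochromatic_copy H (transitive_tournament N) c f"
  shows "M \<le> oriented_ramsey k H"
proof -
  define P where "P N \<longleftrightarrow> (\<forall>(T :: nat pair_pre_digraph) c.
        tournament T \<and> card (pverts T) = N \<and> c ` parcs T \<subseteq> {..<k} \<longrightarrow>
        (\<exists>f. monochromatic_copy H T c f))" for N
  obtain N :: nat where N: "partn_lst {..<N} (replicate (2 * k) n) 2"
    using ramsey_full by blast
  have "P N"
    unfolding P_def
  proof (intro allI impI)
    fix T :: "nat pair_pre_digraph" and c
    assume T: "tournament T \<and> card (pverts T) = N \<and> c ` parcs T \<subseteq> {..<k}"
    then obtain f i where f: "f \<in> {..<n} \<rightarrow> pverts T"
      "\<And>x y. x < y \<Longrightarrow> y < n \<Longrightarrow> (f x, f y) \<in> parcs T \<and> c (f x, f y) = i"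
      using monochromatic_transitive_subtournament[OF N] by metis
    interpret tournament T using T by blast
    have "inj_on f {..<n}"
    proof (rule linorder_inj_onI)
      fix x y assume "x < y" "x \<in> {..<n}" "y \<in> {..<n}"
      then have "(f x, f y) \<in> parcs T" using f(2)[of x y] by simp
      then show "f x \<noteq> f y" using pair_no_loops by fastforce
    qed auto
    moreover have "(f u, f v) \<in> parcs T \<and> c (f u, f v) = i" if "(u, v) \<in> parcs H" for u v
      using f(2) arcs that by blast
    ultimately have "monochromatic_copy H T c f"
      unfolding monochromatic_copy_def digraph_copy_def verts using f(1) by blast
    then show "\<exists>f. monochromatic_copy H T c f" by blast
  qed
  \<comment> \<open>\<open>P\<close> holds at the least value itself, so it is enough to refute
    \<open>P N\<close> for every \<open>N < M\<close>.\<close>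
  then have "P (oriented_ramsey k H)"
    unfolding oriented_ramsey_def P_def[symmetric] by (rule LeastI)
  moreover have "\<not> P N" if "N < M" for N
  proof
    assume "P N"
    moreover have "card (pverts (transitive_tournament N)) = N"
      by (simp add: transitive_tournament_def)
    moreover have "c ` parcs (transitive_tournament N) \<subseteq> {..<k}"
      using c by auto
    ultimately have "\<exists>f. monochromatic_copy H (transitive_tournament N) c f"
      using tournament_transitive_tournament unfolding P_def by blast
    with avoid[OF that] show False by blast
  qed
  ultimately show ?thesis
    using not_le by blast
qed

section \<open>Colourings without monochromatic cliques\<close>

lemma card_supersets:
  assumes "finite E" "B \<subseteq> E"
  shows "card {S. B \<subseteq> S \<and> S \<subseteq> E} \<le> 2 ^ (card E - card B)"
proof -
  have "{S. B \<subseteq> S \<and> S \<subseteq> E} \<subseteq> (\<lambda>S. S \<union> B) ` Pow (E - B)"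
  proof
    fix S assume "S \<in> {S. B \<subseteq> S \<and> S \<subseteq> E}"
    then have "S = (S - B) \<union> B" "S - B \<in> Pow (E - B)" by auto
    then show "S \<in> (\<lambda>S. S \<union> B) ` Pow (E - B)" by (rule image_eqI)
  qed
  then have "card {S. B \<subseteq> S \<and> S \<subseteq> E} \<le> card (Pow (E - B))"
    using assms(1) by (meson card_image_le card_mono finite_Diff finite_Pow_iff finite_imageI le_trans)
  also have "\<dots> = 2 ^ (card E - card B)"
    using assms by (simp add: card_Pow card_Diff_subset finite_subset)
  finally show ?thesis .
qed

text \<open>As \<open>b\<close> ranges over both colours, such a \<open>\<chi>\<close> witnesses
  that the diagonal Ramsey number of \<open>s\<close> exceeds \<open>N\<close>.\<close>

definition clique_free :: "nat \<Rightarrow> nat \<Rightarrow> (nat \<Rightarrow> nat \<Rightarrow> bool) \<Rightarrow> bool" where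
  "clique_free N s \<chi> \<longleftrightarrow>
     \<not> (\<exists>A b. A \<subseteq> {..<N} \<and> card A = s \<and> (\<forall>x\<in>A. \<forall>y\<in>A. x < y \<longrightarrow> \<chi> x y = b))"

text \<open>Erdos' union bound. A colouring is the set \<open>S\<close> of edges of one colour. For
  each of the at most \<open>N ^ s\<close> candidate cliques \<open>A\<close>, the edges of
  \<open>A\<close> lie all inside or all outside \<open>S\<close> for at most
  \<open>2 * 2 ^ (card E - d)\<close> choices of \<open>S\<close>, where
  \<open>d = s choose 2\<close>.\<close>

lemma ex_clique_free:
  assumes small: "2 * N ^ s < 2 ^ (s choose 2)"
  shows "\<exists>\<chi>. clique_free N s \<chi>"
proof -
  define E where "E = [{..<N}]\<^bsup>2\<^esup>"
  have fin: "finite E" by (simp add: E_def finite_imp_finite_nsets)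
  define Q where "Q = [{..<N}]\<^bsup>s\<^esup>"
  have finQ: "finite Q" by (simp add: Q_def finite_imp_finite_nsets)
  define bad where "bad A = {S. [A]\<^bsup>2\<^esup> \<subseteq> S \<and> S \<subseteq> E} \<union> {S. S \<subseteq> E - [A]\<^bsup>2\<^esup>}" for A
  have "\<exists>S. S \<subseteq> E \<and> (\<forall>A\<in>Q. S \<notin> bad A)"
  \<comment> \<open>Without \<open>s\<close>-subsets nothing is to be avoided. Otherwise an
    \<open>s\<close>-subset exists, so \<open>d \<le> card E\<close> and the subtraction
    \<open>card E - d\<close> is not truncated.\<close>
  proof (cases "N < s")
    case True
    then have "Q = {}"
      by (simp add: Q_def nsets_eq_empty)
    then show ?thesis by auto
  next
    case False
    define d where "d = s choose 2"
    have card_bad: "card (bad A) \<le> 2 * 2 ^ (card E - d)" and d_le: "d \<le> card E" if "A \<in> Q" for A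
    proof -
      have A: "[A]\<^bsup>2\<^esup> \<subseteq> E" "card ([A]\<^bsup>2\<^esup>) = d"
        using that nsets_mono[of A "{..<N}" 2] by (auto simp: E_def Q_def d_def nsets_def[of _ s])
      show "d \<le> card E"
        using A fin card_mono by metis
      have "{S. S \<subseteq> E - [A]\<^bsup>2\<^esup>} = Pow (E - [A]\<^bsup>2\<^esup>)" by auto
      then have "card {S. S \<subseteq> E - [A]\<^bsup>2\<^esup>} = 2 ^ (card E - d)"
        using A fin by (metis card_Diff_subset card_Pow finite_Diff finite_subset)
      then show "card (bad A) \<le> 2 * 2 ^ (card E - d)"
        using card_supersets[OF fin A(1)] A(2) card_Un_le[of "{S. [A]\<^bsup>2\<^esup> \<subseteq> S \<and> S \<subseteq> E}" "{S. S \<subseteq> E - [A]\<^bsup>2\<^esup>}"]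
        by (simp add: bad_def)
    qed
    have "d \<le> card E"
      using d_le[of "{..<s}"] False by (auto simp: Q_def nsets_def)
    have "card (\<Union>A\<in>Q. bad A) \<le> (\<Sum>A\<in>Q. card (bad A))"
      by (rule card_UN_le[OF finQ])
    also have "\<dots> \<le> card Q * (2 * 2 ^ (card E - d))"
      using sum_bounded_above[of Q "\<lambda>A. card (bad A)", OF card_bad] by simp
    also have "\<dots> \<le> N ^ s * (2 * 2 ^ (card E - d))"
      using binomial_le_pow[of s N] False by (intro mult_right_mono) (auto simp: Q_def)
    also have "\<dots> = (2 * N ^ s) * 2 ^ (card E - d)" by simp
    also have "\<dots> < 2 ^ d * 2 ^ (card E - d)"
      using small by (intro mult_strict_right_mono) (auto simp: d_def)
    also have "\<dots> = card (Pow E)"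
      using \<open>d \<le> card E\<close> fin by (simp add: card_Pow flip: power_add)
    finally have "card (\<Union>A\<in>Q. bad A) < card (Pow E)" .
    moreover have "(\<Union>A\<in>Q. bad A) \<subseteq> Pow E"
      using nsets_mono by (auto simp: bad_def)
    ultimately have "\<exists>S\<in>Pow E. S \<notin> (\<Union>A\<in>Q. bad A)"
      by (metis less_irrefl subsetI subset_antisym)
    then show ?thesis by auto
  qed
  then obtain S where S: "S \<subseteq> E" "\<And>A. A \<in> Q \<Longrightarrow> S \<notin> bad A" by blast
  have "clique_free N s (\<lambda>x y. {x, y} \<in> S)"
    unfolding clique_free_def
  proof (intro notI, elim exE conjE)
    fix A b
    assume A: "A \<subseteq> {..<N}" "card A = s" and mono: "\<forall>x\<in>A. \<forall>y\<in>A. x < y \<longrightarrow> ({x, y} \<in> S) = b"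
    have "A \<in> Q"
      using A finite_subset by (auto simp: Q_def nsets_def)
    have "(X \<in> S) = b" if X: "X \<in> [A]\<^bsup>2\<^esup>" for X
    proof -
      obtain x y where "X = {x, y}" "x \<in> A" "y \<in> A" "x < y"
        using X by (rule nsets2_lessE)
      then show ?thesis using mono by blast
    qed
    then have "S \<in> bad A"
      using S(1) unfolding bad_def by (cases b) auto
    with S(2)[OF \<open>A \<in> Q\<close>] show False by simp
  qed
  then show ?thesis by blast
qed

section \<open>Lexicographic products\<close>

text \<open>
  Block \<open>a\<close> is \<open>{a * q..<(a + 1) * q}\<close>; the map \<open>f\<close> embeds the \<open>m\<close> blocks starting with block \<open>d\<close>.
  Only the matching edges between these blocks need to be monochromatic.
\<close>

definition avoids :: "nat \<Rightarrow> nat \<Rightarrow> nat \<Rightarrow> (nat \<Rightarrow> nat \<Rightarrow> bool) \<Rightarrow> bool" where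
  "avoids q m K \<chi> \<longleftrightarrow>
     \<not> (\<exists>d f b. d + m \<le> q \<and> strict_mono_on {d * q..<(d + m) * q} f \<and>
          f ` {d * q..<(d + m) * q} \<subseteq> {..<K} \<and>
          (\<forall>a c. d \<le> a \<longrightarrow> a < c \<longrightarrow> c < d + m \<longrightarrow> \<chi> (f (a * q + c)) (f (c * q + a)) = b))"

text \<open>The number \<open>u\<close> encodes the pair (\<open>u div K\<close>,
  \<open>u mod K\<close>), so that the order of numbers is the lexicographic order of pairs and
  increasing maps have nondecreasing top coordinates.\<close>

definition lex_coloring ::
    "nat \<Rightarrow> (nat \<Rightarrow> nat \<Rightarrow> bool) \<Rightarrow> (nat \<Rightarrow> nat \<Rightarrow> bool) \<Rightarrow> nat \<Rightarrow> nat \<Rightarrow> bool" where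
  "lex_coloring K \<chi> \<psi> u v =
     (if u div K = v div K then \<psi> (u mod K) (v mod K) else \<chi> (u div K) (v div K))"

text \<open>Start of the iteration: the \<open>q\<close> vertices of one block do not fit into
  \<open>K\<close> points.\<close>

lemma avoids_single_block:
  assumes "K < q"
  shows "avoids q 1 K \<chi>"
  unfolding avoids_def
proof (intro notI, elim exE conjE)
  fix d f b
  assume f: "strict_mono_on {d * q..<(d + 1) * q} f" "f ` {d * q..<(d + 1) * q} \<subseteq> {..<K}"
  have "card {d * q..<(d + 1) * q} \<le> card {..<K}"
    using f by (intro card_inj_on_le[OF strict_mono_on_imp_inj_on]) auto
  with assms show False by simp
qed

lemma avoids_lex_coloring:
  assumes \<chi>: "clique_free N s \<chi>" and \<psi>: "avoids q m K \<psi>" and m: "0 < m"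
  shows "avoids q (N + s * m) (N * K) (lex_coloring K \<chi> \<psi>)"
  unfolding avoids_def
proof (intro notI, elim exE conjE)
  fix d f b
  let ?M = "N + s * m"
  let ?I = "{d * q..<(d + ?M) * q}"
  assume le_q: "d + ?M \<le> q" and f_mono: "strict_mono_on ?I f" and f_le: "f ` ?I \<subseteq> {..<N * K}"
    and col: "\<forall>a c. d \<le> a \<longrightarrow> a < c \<longrightarrow> c < d + ?M \<longrightarrow>
      lex_coloring K \<chi> \<psi> (f (a * q + c)) (f (c * q + a)) = b"
  define J where "J = {d..<d + ?M}"
  have in_I: "a * q + c \<in> ?I" if "a \<in> J" "c < q" for a c
  proof -
    have "a * q + c < Suc a * q" using that(2) by simp
    also have "\<dots> \<le> (d + ?M) * q" using that(1) by (intro mult_right_mono) (auto simp: J_def)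
    finally have "a * q + c < (d + ?M) * q" .
    moreover have "d * q \<le> a * q + c"
      using that(1) by (intro trans_le_add1 mult_right_mono) (auto simp: J_def)
    ultimately show ?thesis by simp
  qed
  have block_less: "a * q + x < c * q + y" if "a < c" "x < q" for a c x y :: nat
  proof -
    have "a * q + x < Suc a * q" using that(2) by simp
    also have "\<dots> \<le> c * q" using that(1) by (intro mult_right_mono) auto
    finally show ?thesis by simp
  qed
  define g where "g v = f v div K" for v
  have g_mono: "g u \<le> g v" if "u \<in> ?I" "v \<in> ?I" "u \<le> v" for u v
    using strict_mono_on_leD[OF f_mono that] by (simp add: g_def div_le_mono)
  have g_less: "g v < N" if "v \<in> ?I" for v
  proof -
    have "f v < N * K" using f_le that by blast
    then show ?thesis by (simp add: g_def less_mult_imp_div_less)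
  qed
  \<comment> \<open>\<open>h\<close> and \<open>h'\<close> are the top coordinates of the first and
    last vertex of a block; \<open>F\<close> consists of the unbroken blocks, which lie above a
    single point.\<close>
  define h where "h a = g (a * q)" for a
  define h' where "h' a = g (a * q + (q - 1))" for a
  define F where "F = {a \<in> J. h a = h' a}"
  have q: "0 < q" if "a \<in> J" for a
    using that le_q by (auto simp: J_def)
  have h_less: "h a < N" if "a \<in> J" for a
    using g_less[OF in_I[OF that, of 0]] q[OF that] by (simp add: h_def)
  have h'_le_h: "h' a \<le> h c" if "a \<in> J" "c \<in> J" "a < c" for a c
    unfolding h_def h'_def
    using in_I[OF that(1), of "q - 1"] in_I[OF that(2), of 0] block_less[OF that(3), of "q - 1" 0] q[OF that(1)]
    by (intro g_mono) auto
  have h_le_h': "h a \<le> h' a" if "a \<in> J" for a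
    unfolding h_def h'_def
    using in_I[OF that, of "q - 1"] in_I[OF that, of 0] q[OF that] by (intro g_mono) auto
  have full: "g (a * q + c) = h a" if "a \<in> F" "c < q" for a c
  proof (rule antisym)
    have a: "a \<in> J" "h a = h' a" using that(1) by (auto simp: F_def)
    show "h a \<le> g (a * q + c)"
      unfolding h_def using in_I[OF a(1), of 0] in_I[OF a(1) that(2)] that(2) by (intro g_mono) auto
    show "g (a * q + c) \<le> h a"
      unfolding a(2) h'_def
      using in_I[OF a(1), of "q - 1"] in_I[OF a(1) that(2)] that(2) by (intro g_mono) auto
  qed
  \<comment> \<open>Inside a broken block the top coordinate strictly increases, and it never
    decreases afterwards, so broken blocks start above distinct points.\<close>
  have "card (J - F) \<le> card {..<N}"
  proof (rule card_inj_on_le)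
    show "inj_on h (J - F)"
    proof (rule linorder_inj_onI)
      fix a c assume "a < c" "a \<in> J - F" "c \<in> J - F"
      then have "h a < h' a" "h' a \<le> h c"
        using h_le_h'[of a] h'_le_h[of a c] by (auto simp: F_def)
      then show "h a \<noteq> h c" by simp
    qed auto
    show "h ` (J - F) \<subseteq> {..<N}" using h_less by auto
  qed auto
  moreover have "card (J - F) = ?M - card F"
    by (subst card_Diff_subset) (auto simp: F_def J_def)
  ultimately have card_F: "s * m \<le> card F" by simp
  have fin_F: "finite F" by (simp add: F_def J_def)
  \<comment> \<open>The unbroken blocks above \<open>x\<close> need not be known to be consecutive:
    by monotonicity everything between the first, \<open>l\<close>, and the last, \<open>r\<close>,
    lies above \<open>x\<close> too. Thus \<open>m\<close> of them yield a run of \<open>m\<close>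
    blocks from \<open>l\<close> on, which is why \<open>avoids\<close> quantifies over the starting
    block.\<close>
  have fibre: "card {a \<in> F. h a = x} < m" for x
  proof (rule ccontr)
    define A where "A = {a \<in> F. h a = x}"
    assume "\<not> card {a \<in> F. h a = x} < m"
    then have card_A: "m \<le> card A" by (simp add: A_def)
    have fin_A: "finite A" using fin_F by (simp add: A_def)
    have "A \<noteq> {}" using card_A m by auto
    define l where "l = Min A"
    define r where "r = Max A"
    have lr: "l \<in> A" "r \<in> A" using fin_A \<open>A \<noteq> {}\<close> by (auto simp: l_def r_def)
    have "A \<subseteq> {l..r}" using fin_A by (auto simp: l_def r_def)
    then have "card A \<le> Suc r - l" using card_mono[of "{l..r}" A] by simp
    then have lm: "l + m \<le> Suc r" using card_A m by linarith
    have lr_J: "l \<in> J" "r \<in> J" "h l = x" "h' r = x" using lr by (auto simp: A_def F_def)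
    have sub: "{l * q..<(l + m) * q} \<subseteq> {l * q..r * q + (q - 1)}"
    proof -
      have "(l + m) * q \<le> Suc r * q" using lm by (rule mult_right_mono) simp
      then show ?thesis by auto
    qed
    have sub_I: "{l * q..r * q + (q - 1)} \<subseteq> ?I"
    proof
      fix v assume "v \<in> {l * q..r * q + (q - 1)}"
      moreover have "d * q \<le> l * q" using lr_J(1) by (intro mult_right_mono) (auto simp: J_def)
      moreover have "r * q + (q - 1) < (d + ?M) * q"
        using in_I[OF lr_J(2), of "q - 1"] q[OF lr_J(1)] by simp
      ultimately show "v \<in> ?I"
        unfolding atLeastAtMost_iff atLeastLessThan_iff by linarith
    qed
    have g_x: "g v = x" if "v \<in> {l * q..<(l + m) * q}" for v
    proof (rule antisym)
      have v: "v \<in> {l * q..r * q + (q - 1)}" using that sub by blast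
      have I: "l * q \<in> ?I" "r * q + (q - 1) \<in> ?I" "v \<in> ?I"
        using in_I[OF lr_J(1), of 0] in_I[OF lr_J(2), of "q - 1"] q[OF lr_J(1)] v sub_I by auto
      show "g v \<le> x" using g_mono[OF I(3,2)] v lr_J(4) by (simp add: h'_def)
      show "x \<le> g v" using g_mono[OF I(1,3)] v lr_J(3) by (simp add: h_def)
    qed
    \<comment> \<open>On this run \<open>f\<close> and \<open>f'\<close> differ by the constant
      \<open>x * K\<close>, so \<open>f'\<close> is an increasing map into the lower level.\<close>
    define f' where "f' v = f v mod K" for v
    have f_eq: "f v = x * K + f' v" if "v \<in> {l * q..<(l + m) * q}" for v
      unfolding f'_def g_x[OF that, symmetric] g_def by simp
    have "strict_mono_on {l * q..<(l + m) * q} f'"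
    proof (rule strict_mono_onI)
      fix u v assume uv: "u \<in> {l * q..<(l + m) * q}" "v \<in> {l * q..<(l + m) * q}" "u < v"
      have "u \<in> ?I" "v \<in> ?I" using uv sub sub_I by blast+
      then have "f u < f v" using strict_mono_onD[OF f_mono] uv(3) by blast
      then show "f' u < f' v" using f_eq[OF uv(1)] f_eq[OF uv(2)] by simp
    qed
    moreover have "f' ` {l * q..<(l + m) * q} \<subseteq> {..<K}"
    proof -
      have "0 < K"
        using f_le in_I[OF lr_J(1), of 0] q[OF lr_J(1)] by (cases "K = 0") auto
      then show ?thesis by (auto simp: f'_def)
    qed
    moreover have "l + m \<le> q"
      using lm lr_J(2) le_q by (auto simp: J_def)
    moreover have "\<psi> (f' (a * q + c)) (f' (c * q + a)) = b" if "l \<le> a" "a < c" "c < l + m" for a c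
    proof -
      have ac: "a \<in> J" "c \<in> J" "a < q" "c < q"
        using that lr_J lm le_q by (auto simp: J_def)
      have "a * q + c \<in> {l * q..<(l + m) * q}"
        using block_less[of a "l + m" c 0] that ac by (auto intro: trans_le_add1)
      moreover have "c * q + a \<in> {l * q..<(l + m) * q}"
        using block_less[of c "l + m" a 0] that ac by (auto intro: trans_le_add1)
      ultimately have "f (a * q + c) div K = f (c * q + a) div K"
        using g_x by (simp add: g_def)
      moreover have "lex_coloring K \<chi> \<psi> (f (a * q + c)) (f (c * q + a)) = b"
        using col that ac by (auto simp: J_def)
      ultimately show ?thesis by (simp add: lex_coloring_def f'_def)
    qed
    ultimately show False using \<psi> unfolding avoids_def by blast
  qed
  \<comment> \<open>Pigeonhole: at least \<open>s * m\<close> unbroken blocks, with fewer than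
    \<open>m\<close> above each point.\<close>
  have "s \<le> card (h ` F)"
  proof (cases "s = 0")
    case False
    then have "F \<noteq> {}" using card_F m by auto
    then obtain x where "card F \<le> card (h -` {x} \<inter> F) * card (h ` F)"
      using pigeonhole_card[of h F "h ` F"] fin_F by auto
    also have "h -` {x} \<inter> F = {a \<in> F. h a = x}" by auto
    also have "card {a \<in> F. h a = x} * card (h ` F) \<le> m * card (h ` F)"
      using fibre[of x] by simp
    finally have "m * s \<le> m * card (h ` F)" using card_F by (simp only: mult.commute)
    then show ?thesis using m by simp
  qed simp
  then obtain X where X: "X \<subseteq> h ` F" "card X = s"
    by (meson obtain_subset_with_card_n)
  \<comment> \<open>The matching edge between unbroken blocks \<open>a\<close> and \<open>c\<close>
    has its ends above \<open>x\<close> and \<open>y\<close>, so its colour \<open>b\<close> is the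
    top-level colour of this pair.\<close>
  have mono: "\<chi> x y = b" if xy: "x \<in> X" "y \<in> X" "x < y" for x y
  proof -
    obtain a c where ac: "a \<in> F" "c \<in> F" "x = h a" "y = h c" using xy X by blast
    then have J: "a \<in> J" "c \<in> J" "h a = h' a" "h c = h' c" by (auto simp: F_def)
    have "a < c"
    proof (rule ccontr)
      assume "\<not> a < c"
      then have "c = a \<or> h' c \<le> h a" using h'_le_h[OF J(2,1)] by linarith
      then show False using xy(3) ac J by auto
    qed
    have "a < q" "c < q" using J le_q by (auto simp: J_def)
    then have "g (a * q + c) = x" "g (c * q + a) = y" using full ac by auto
    moreover have "lex_coloring K \<chi> \<psi> (f (a * q + c)) (f (c * q + a)) = b"
      using col \<open>a < c\<close> J by (auto simp: J_def)
    ultimately show ?thesis using xy(3) by (auto simp: lex_coloring_def g_def)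
  qed
  have "h ` F \<subseteq> {..<N}" using h_less unfolding F_def by blast
  with X(1) have "X \<subseteq> {..<N}" by (rule subset_trans)
  then have "\<exists>A b. A \<subseteq> {..<N} \<and> card A = s \<and> (\<forall>x\<in>A. \<forall>y\<in>A. x < y \<longrightarrow> \<chi> x y = b)"
    by (intro exI[of _ X] exI[of _ b] conjI ballI impI X(2) mono)
  with \<chi> show False unfolding clique_free_def by contradiction
qed

text \<open>With \<open>t = 2 ^ (p - 2)\<close> and \<open>s = 2 * t\<close>,
  \<open>s choose 2\<close> equals \<open>(t - 1) * s + t\<close>, while \<open>N ^ s\<close> is at
  most \<open>2 ^ ((t - 1) * s)\<close>. The factor 2 in the counting bound is absorbed because
  \<open>t \<ge> 2\<close>.\<close>

lemma ex_clique_free_power: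
  assumes "j \<le> 2 ^ (p - 2)" "3 \<le> p" and N: "N \<le> 2 ^ (j - 1)"
  shows "\<exists>\<chi>. clique_free N (2 ^ (p - 1)) \<chi>"
proof (rule ex_clique_free)
  define s :: nat where "s = 2 ^ (p - 1)"
  define t :: nat where "t = 2 ^ (p - 2)"
  have p: "p - 1 = Suc (p - 2)" using assms(2) by simp
  have s: "s = 2 * t" unfolding s_def t_def p by simp
  have "(2::nat) ^ 1 \<le> 2 ^ (p - 2)" using assms(2) by (intro power_increasing) auto
  then have t: "2 \<le> t" by (simp add: t_def)
  have "2 * N ^ s \<le> 2 * (2 ^ (j - 1)) ^ s"
    using N by (intro mult_left_mono power_mono) auto
  also have "\<dots> = 2 ^ Suc ((j - 1) * s)" by (simp add: power_mult)
  also have "\<dots> \<le> 2 ^ Suc ((t - 1) * s)"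
    using assms(1) by (intro power_increasing Suc_le_mono[THEN iffD2] mult_right_mono) (auto simp: t_def)
  also have "\<dots> < 2 ^ (s choose 2)"
  proof (rule power_strict_increasing)
    obtain t' where "t = t' + 2" using t le_Suc_ex by (metis add.commute)
    then show "Suc ((t - 1) * s) < s choose 2"
      by (simp add: s choose_two algebra_simps)
  qed auto
  finally show "2 * N ^ 2 ^ (p - 1) < 2 ^ (2 ^ (p - 1) choose 2)"
    by (simp add: s_def)
qed

text \<open>Each round takes \<open>s = 2 ^ (p - 1)\<close>, \<open>m = 2 ^ (p * r)\<close> and
  \<open>N = s * m\<close>, so the run length \<open>N + s * m\<close> is \<open>2 ^ p * m\<close>,
  and the exponent of the number of vertices grows by \<open>p - 1 + p * r\<close>.\<close>

lemma ex_avoids: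
  assumes j: "0 < j" "j \<le> 2 ^ (p - 2)" and p: "3 \<le> p" and r: "p * r \<le> j"
  shows "\<exists>\<chi>. avoids (2 ^ j) (2 ^ (p * r)) (2 ^ (j - 1 + (\<Sum>i<r. p - 1 + p * i))) \<chi>"
  using r
proof (induction r)
  case 0
  have "(2::nat) ^ (j - 1) < 2 ^ j" using j(1) by simp
  then show ?case using avoids_single_block by auto
next
  case (Suc r)
  let ?N = "2 ^ (p - 1 + p * r) :: nat"
  obtain \<psi> where "avoids (2 ^ j) (2 ^ (p * r)) (2 ^ (j - 1 + (\<Sum>i<r. p - 1 + p * i))) \<psi>"
    using Suc by auto
  \<comment> \<open>The exponent is \<open>p * Suc r - 1\<close>; the bound
    \<open>p * Suc r \<le> j\<close> keeps it within the range of the clique-free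
    colourings.\<close>
  moreover have "?N \<le> 2 ^ (j - 1)"
    using Suc.prems p by (intro power_increasing) auto
  then obtain \<chi> where "clique_free ?N (2 ^ (p - 1)) \<chi>"
    using ex_clique_free_power j p by blast
  ultimately have "avoids (2 ^ j) (?N + 2 ^ (p - 1) * 2 ^ (p * r))
      (?N * 2 ^ (j - 1 + (\<Sum>i<r. p - 1 + p * i)))
      (lex_coloring (2 ^ (j - 1 + (\<Sum>i<r. p - 1 + p * i))) \<chi> \<psi>)"
    by (intro avoids_lex_coloring) auto
  moreover have "?N + 2 ^ (p - 1) * 2 ^ (p * r) = 2 ^ (p * Suc r)"
  proof -
    have "?N + 2 ^ (p - 1) * 2 ^ (p * r) = 2 ^ Suc (p - 1 + p * r)" by (simp add: power_add)
    also have "Suc (p - 1 + p * r) = p * Suc r" using p by simp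
    finally show ?thesis .
  qed
  moreover have "?N * 2 ^ (j - 1 + (\<Sum>i<r. p - 1 + p * i)) =
      2 ^ (j - 1 + (\<Sum>i<Suc r. p - 1 + p * i))"
    by (simp add: power_add)
  ultimately show ?case by auto
qed

section \<open>The digraph\<close>

text \<open>\<open>\<sigma>\<close> is meant to be an involution: \<open>u < v\<close> keeps one arc
  of each pair it swaps and discards its fixed points.\<close>

definition path_matching :: "nat \<Rightarrow> (nat \<Rightarrow> nat) \<Rightarrow> nat pair_pre_digraph" where
  "path_matching n \<sigma> =
     \<lparr>pverts = {..<n}, parcs = {(u, v). u < v \<and> v < n \<and> (v = Suc u \<or> v = \<sigma> u)}\<rparr>"

lemma pverts_path_matching [simp]: "pverts (path_matching n \<sigma>) = {..<n}"
  by (simp add: path_matching_def)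

lemma parcs_path_matching [simp]:
  "(u, v) \<in> parcs (path_matching n \<sigma>) \<longleftrightarrow> u < v \<and> v < n \<and> (v = Suc u \<or> v = \<sigma> u)"
  by (simp add: path_matching_def)

lemma parcs_path_matching_subset: "parcs (path_matching n \<sigma>) \<subseteq> {(u, v). u < v \<and> v < n}"
  by auto

lemma oriented_digraph_path_matching: "oriented_digraph (path_matching n \<sigma>)"
proof -
  have "parcs (path_matching n \<sigma>) \<subseteq> {..<n} \<times> {..<n}" by auto
  then have "finite (parcs (path_matching n \<sigma>))" by (rule finite_subset) simp
  then show ?thesis by unfold_locales auto
qed

lemma acyclic_path_matching: "acyclic (parcs (path_matching n \<sigma>))"
  by (rule acyclic_subset[OF wf_acyclic[OF wf]]) auto

text \<open>All neighbours of \<open>v\<close> are among \<open>v - 1\<close>, \<open>Suc v\<close>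
  and \<open>\<sigma> v\<close>; at \<open>w\<close> these are three distinct neighbours.\<close>

lemma max_degree_path_matching:
  assumes inv: "\<And>x. \<sigma> (\<sigma> x) = x" and w: "0 < w" "Suc w < \<sigma> w" "\<sigma> w < n"
  shows "max_degree (path_matching n \<sigma>) = 3"
proof -
  let ?H = "path_matching n \<sigma>"
  let ?deg = "\<lambda>v. card (out_nbrs ?H v) + card (in_nbrs ?H v)"
  have "?deg v \<le> 3" for v
  proof -
    define S where "S = {v - 1, Suc v, \<sigma> v}"
    have "in_nbrs ?H v \<subseteq> S" "out_nbrs ?H v \<subseteq> S" "in_nbrs ?H v \<inter> out_nbrs ?H v = {}"
      using inv by (auto simp: S_def in_nbrs_def out_nbrs_def)
    then have "?deg v \<le> card S"
      by (metis S_def Un_commute Un_least card_Un_disjoint card_mono finite.emptyI finite.insertI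
          finite_subset Int_commute)
    also have "card S \<le> 3" by (simp add: S_def card_insert_if)
    finally show ?thesis .
  qed
  moreover have "?deg w = 3"
  proof -
    have "out_nbrs ?H w = {Suc w, \<sigma> w}"
      using w by (auto simp: out_nbrs_def)
    moreover have "in_nbrs ?H w = {w - 1}"
      using w inv by (auto simp: in_nbrs_def)
    ultimately show ?thesis using w by simp
  qed
  ultimately show ?thesis
    unfolding max_degree_def using w by (intro Max_eqI) (auto intro!: image_eqI[of _ _ w])
qed

lemma strict_mono_on_path_copy:
  assumes "digraph_copy (path_matching n \<sigma>) (transitive_tournament N) f"
  shows "strict_mono_on {..<n} f"
proof (rule strict_mono_onI)
  fix u v assume "u \<in> {..<n}" "v \<in> {..<n}" "u < v"
  then have "v < n" by simp
  have "(f x, f (Suc x)) \<in> parcs (transitive_tournament N)" if "Suc x < n" for x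
    using assms that by (auto simp: digraph_copy_def)
  then have step: "f x < f (Suc x)" if "Suc x < n" for x
    using that by (simp add: transitive_tournament_def)
  show "f u < f v"
    using \<open>u < v\<close> \<open>v < n\<close>
  proof (induction v)
    case (Suc v)
    then show ?case using step[of v] by (cases "u = v") auto
  qed simp
qed

lemma oriented_ramsey_path_matching_ge:
  assumes "0 < k"
  shows "n \<le> oriented_ramsey k (path_matching n \<sigma>)"
proof (rule le_oriented_ramsey[where c = "\<lambda>_. 0"])
  fix N f assume "N < n"
  show "\<not> monochromatic_copy (path_matching n \<sigma>) (transitive_tournament N) (\<lambda>_. 0) f"
  proof
    assume "monochromatic_copy (path_matching n \<sigma>) (transitive_tournament N) (\<lambda>_. 0) f"
    then have "inj_on f {..<n}" "f ` {..<n} \<subseteq> {..<N}"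
      by (auto simp: monochromatic_copy_def digraph_copy_def transitive_tournament_def)
    then have "card {..<n} \<le> card {..<N}" by (intro card_inj_on_le) auto
    with \<open>N < n\<close> show False by simp
  qed
qed (use assms parcs_path_matching_subset in auto)

text \<open>Transposition of a \<open>q\<close> by \<open>q\<close> array stored row by row,
  extended by the identity so that it is an involution on all numbers.\<close>

definition block_swap :: "nat \<Rightarrow> nat \<Rightarrow> nat" where
  "block_swap q x = (if x < q * q then (x mod q) * q + x div q else x)"

lemma block_swap: "a < q \<Longrightarrow> c < q \<Longrightarrow> block_swap q (a * q + c) = c * q + a"
proof -
  assume *: "a < q" "c < q"
  have "a * q + c < Suc a * q" using * by simp
  also have "\<dots> \<le> q * q" using * by (intro mult_right_mono) auto
  finally show ?thesis using * by (simp add: block_swap_def)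
qed

lemma block_swap_block_swap: "block_swap q (block_swap q x) = x"
proof (cases "x < q * q")
  case True
  then have "0 < q" by (cases q) auto
  then have "x div q < q" "x mod q < q"
    using True by (auto simp: less_mult_imp_div_less)
  then show ?thesis
    using block_swap[of "x div q" q "x mod q"] block_swap[of "x mod q" q "x div q"] by simp
qed (simp add: block_swap_def)

text \<open>The two colours of \<open>\<chi>\<close> become 0 and 1. A monochromatic copy,
  restricted to its first \<open>m\<close> blocks, would contradict \<open>avoids\<close> at
  \<open>d = 0\<close>.\<close>

lemma oriented_ramsey_block_swap:
  assumes \<chi>: "avoids q m K \<chi>" and "m \<le> q" "q * q \<le> n" "2 \<le> k"
  shows "K \<le> oriented_ramsey k (path_matching n (block_swap q))"
proof -
  let ?H = "path_matching n (block_swap q)"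
  define c :: "nat \<times> nat \<Rightarrow> nat" where "c = (\<lambda>(u, v). if \<chi> u v then 1 else 0)"
  show ?thesis
  proof (rule le_oriented_ramsey[where c = c])
    show "c (u, v) < k" for u v using \<open>2 \<le> k\<close> by (simp add: c_def)
    fix N f assume "N < K"
    show "\<not> monochromatic_copy ?H (transitive_tournament N) c f"
    proof
      assume "monochromatic_copy ?H (transitive_tournament N) c f"
      then obtain i where copy: "digraph_copy ?H (transitive_tournament N) f"
        and i: "\<forall>(u, v) \<in> parcs ?H. c (f u, f v) = i"
        by (auto simp: monochromatic_copy_def)
      have sub: "{0 * q..<(0 + m) * q} \<subseteq> {..<n}"
      proof -
        have "m * q \<le> n"
          using mult_right_mono[OF \<open>m \<le> q\<close>, of q] \<open>q * q \<le> n\<close> by linarith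
        then show ?thesis by auto
      qed
      have mono: "strict_mono_on {0 * q..<(0 + m) * q} f"
        using strict_mono_on_path_copy[OF copy] sub by (auto simp: strict_mono_on_def)
      have "f ` {..<n} \<subseteq> {..<N}"
        using copy by (simp add: digraph_copy_def transitive_tournament_def)
      moreover have "{..<N} \<subseteq> {..<K}" using \<open>N < K\<close> by auto
      ultimately have range: "f ` {0 * q..<(0 + m) * q} \<subseteq> {..<K}"
        using image_mono[OF sub, of f] by (meson subset_trans)
      have col: "\<chi> (f (a * q + b)) (f (b * q + a)) = (i = 1)" if ab: "a < b" "b < 0 + m" for a b
      proof -
        have "b * q + a < q * q"
        proof -
          have "b * q + a < Suc b * q" using ab \<open>m \<le> q\<close> by simp
          also have "\<dots> \<le> q * q" using ab \<open>m \<le> q\<close> by (intro mult_right_mono) auto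
          finally show ?thesis .
        qed
        \<comment> \<open>The difference is \<open>(b - a) * (q - 1)\<close>, and
          \<open>q > 1\<close> since \<open>a < b < q\<close>.\<close>
        moreover have "a * q + b < b * q + a"
        proof -
          obtain e where e: "b = Suc (a + e)" using less_imp_Suc_add[OF ab(1)] by blast
          show ?thesis using ab \<open>m \<le> q\<close> by (simp add: e algebra_simps)
        qed
        ultimately have "(a * q + b, b * q + a) \<in> parcs ?H"
          using ab \<open>m \<le> q\<close> \<open>q * q \<le> n\<close> by (simp add: block_swap)
        then have "c (f (a * q + b), f (b * q + a)) = i" using i by blast
        then show ?thesis by (auto simp: c_def split: if_splits)
      qed
      have "0 + m \<le> q" using \<open>m \<le> q\<close> by simp
      then have "\<exists>d f b. d + m \<le> q \<and> strict_mono_on {d * q..<(d + m) * q} f \<and>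
          f ` {d * q..<(d + m) * q} \<subseteq> {..<K} \<and>
          (\<forall>a c. d \<le> a \<longrightarrow> a < c \<longrightarrow> c < d + m \<longrightarrow> \<chi> (f (a * q + c)) (f (c * q + a)) = b)"
        by (intro exI[of _ 0] exI[of _ f] exI[of _ "i = 1"] conjI allI impI mono range col)
      with \<chi> show False unfolding avoids_def by contradiction
    qed
  qed (use parcs_path_matching_subset in auto)
qed

section \<open>The numerical bound\<close>

lemma double_sum_exponents:
  assumes "1 \<le> p"
  shows "2 * real (\<Sum>i<r. p - 1 + p * i) = real p * r * (r + 1) - 2 * r"
  using assms by (induction r) (auto simp: algebra_simps of_nat_diff)

lemma exponent_bound:
  fixes L :: real
  assumes L: "16 \<le> L" and j: "j = nat \<lfloor>L / 2\<rfloor>"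
  obtains p where "3 \<le> p" "j \<le> 2 ^ (p - 2)"
    "L / (20 * log 2 L) * L \<le> real (j - 1 + (\<Sum>i<j div p. p - 1 + p * i))"
proof -
  have j8: "8 \<le> j" and j_le: "real j \<le> L / 2" and j_gt: "L / 2 - 1 < j"
    using L by (auto simp: j le_nat_floor) linarith+
  \<comment> \<open>Minimality gives \<open>2 ^ (p - 3) < j\<close>, hence
    \<open>p < log 2 L + 2\<close>.\<close>
  define p where "p = (LEAST p. j \<le> 2 ^ (p - 2))"
  have ex: "j \<le> 2 ^ ((j + 2) - 2)" by (simp add: less_imp_le)
  have jp: "j \<le> 2 ^ (p - 2)" unfolding p_def by (rule LeastI[of _ "j + 2"]) (rule ex)
  have p3: "3 < p"
  proof (rule ccontr)
    assume "\<not> 3 < p"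
    then have "(2::nat) ^ (p - 2) \<le> 2 ^ 1" by (intro power_increasing) auto
    then show False using jp j8 by simp
  qed
  have "p - 1 - 2 = p - 3" by simp
  then have "2 ^ (p - 3) < j"
    using not_less_Least[of "p - 1" "\<lambda>p. j \<le> 2 ^ (p - 2)"] p3
    by (simp add: p_def[symmetric] not_le)
  then have "real (2 ^ (p - 3)) < real j" by (simp only: of_nat_less_iff)
  then have "2 powr (real p - 3) < L / 2"
    using j_le p3 by (simp add: powr_realpow[symmetric] of_nat_diff)
  then have "real p - 3 < log 2 (L / 2)"
    using L by (simp add: less_log_iff)
  also have "log 2 (L / 2) = log 2 L - 1" using L by (simp add: log_divide)
  finally have p_less: "real p < log 2 L + 2" by simp
  have log4: "4 \<le> log 2 L" using L by (simp add: le_log_iff)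
  define r where "r = j div p"
  have jr: "real j + 1 \<le> real p * (r + 1)"
  proof -
    have "j < p * (r + 1)"
      unfolding r_def using p3 dividend_less_times_div[of p j] by (simp add: algebra_simps)
    then have "real (j + 1) \<le> real (p * (r + 1))" by (intro of_nat_mono) simp
    then show ?thesis by (simp only: of_nat_mult of_nat_add of_nat_1)
  qed
  define e where "e = real (j - 1 + (\<Sum>i<r. p - 1 + p * i))"
  have e: "0 \<le> e" unfolding e_def by (rule of_nat_0_le_iff)
  \<comment> \<open>The initial summand \<open>j - 1\<close> of \<open>e\<close> turns the factor
    \<open>r\<close> into \<open>r + 2\<close>; multiplied by \<open>p\<close>, this is at least
    \<open>j + 1 + p\<close>, which makes up for the rounding in \<open>j\<close> and
    \<open>r\<close>.\<close>
  have "2 * e = 2 * (real j - 1) + (real p * r * (r + 1) - 2 * r)"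
    using double_sum_exponents[of p r] p3 j8 by (simp add: e_def of_nat_diff)
  also have "\<dots> \<ge> 2 * (real j - 1) + ((real j + 1) * r - 2 * r)"
    using mult_right_mono[OF jr, of r] by (simp add: algebra_simps)
  also have "2 * (real j - 1) + ((real j + 1) * r - 2 * r) = (real j - 1) * (r + 2)"
    by (simp add: algebra_simps)
  finally have "(real j - 1) * (r + 2) \<le> 2 * e" .
  then have "(real j - 1) * (r + 2) * p \<le> 2 * e * p"
    by (rule mult_right_mono) simp
  moreover have "(real j - 1) * (real j + 1 + p) \<le> (real j - 1) * ((r + 2) * p)"
    using jr j8 by (intro mult_left_mono) (auto simp: algebra_simps)
  moreover have "(L / 2 - 2) * (L / 2 + 2) \<le> (real j - 1) * (real j + 1 + p)"
    using j_gt L p3 by (intro mult_mono) auto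
  ultimately have "L ^ 2 / 4 - 4 \<le> 2 * e * p"
    by (simp add: algebra_simps power2_eq_square)
  also have "\<dots> \<le> 2 * e * (log 2 L + 2)"
    using p_less by (intro mult_left_mono) (auto simp: e)
  finally have "L ^ 2 - 16 \<le> 8 * e * (log 2 L + 2)" by simp
  \<comment> \<open>\<open>L \<ge> 16\<close> gives \<open>2 \<le> log 2 L / 2\<close>; below, it
    also lets the constant 20 absorb the term 16.\<close>
  also have "\<dots> \<le> 8 * e * (3 / 2 * log 2 L)"
    using log4 by (intro mult_left_mono) (auto simp: e)
  finally have "L ^ 2 - 16 \<le> 12 * e * log 2 L" by simp
  moreover have "16 ^ 2 \<le> L ^ 2" using L by (intro power_mono) auto
  ultimately have "L ^ 2 \<le> 20 * e * log 2 L" by simp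
  then have "L / (20 * log 2 L) * L \<le> e"
    using log4 by (simp add: divide_simps power2_eq_square mult_ac)
  then show ?thesis using that[of p] p3 jp by (simp add: e_def r_def)
qed

theorem theorem1p6:
  fixes n :: nat
  assumes "n \<ge> 4"
  shows "\<exists>H :: nat pair_pre_digraph.
           oriented_digraph H \<and> acyclic (parcs H) \<and> card (pverts H) = n \<and> max_degree H = 3 \<and>
           (\<forall>k \<ge> 2. real (oriented_ramsey k H) \<ge>
              real n powr (log 2 (real n) / (20 * log 2 (log 2 (real n)))))"
proof -
  define L where "L = log 2 (real n)"
  have n_L: "real n = 2 powr L" using assms by (simp add: L_def)
  have bound_eq: "real n powr (L / (20 * log 2 L)) = 2 powr (L / (20 * log 2 L) * L)"
    by (simp add: n_L powr_powr mult.commute)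
  have "\<exists>\<sigma>. (\<forall>x. \<sigma> (\<sigma> x) = x) \<and> (\<exists>w>0. Suc w < \<sigma> w \<and> \<sigma> w < n) \<and>
      (\<forall>k\<ge>2. real n powr (L / (20 * log 2 L)) \<le> oriented_ramsey k (path_matching n \<sigma>))"
  \<comment> \<open>For \<open>L < 16\<close> the exponent is at most 1, and the trivial bound
    \<open>n\<close> suffices.\<close>
  proof (cases "L < 16")
    case True
    have "2 \<le> L" using assms by (simp add: L_def le_log_iff)
    then have "1 \<le> log 2 L" by (simp add: le_log_iff)
    then have "L / (20 * log 2 L) \<le> 1" using True by (simp add: divide_simps)
    then have le_n: "real n powr (L / (20 * log 2 L)) \<le> n"
      using assms powr_mono[of "L / (20 * log 2 L)" 1 n] by simp
    have "real n powr (L / (20 * log 2 L)) \<le> oriented_ramsey k (path_matching n \<sigma>)"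
      if "2 \<le> k" for k \<sigma>
    proof -
      have "real n \<le> oriented_ramsey k (path_matching n \<sigma>)"
        using oriented_ramsey_path_matching_ge[of k n \<sigma>] that by simp
      with le_n show ?thesis by linarith
    qed
    \<comment> \<open>The trivial bound holds for every \<open>\<sigma>\<close>; swapping 1 and 3
      fits into four vertices and gives vertex 1 degree 3.\<close>
    then show ?thesis
      using assms
      by (intro exI[of _ "id(1 := 3, 3 := 1)"]) (auto intro!: exI[of _ 1])
  next
    case False
    then have L: "16 \<le> L" by simp
    define j where "j = nat \<lfloor>L / 2\<rfloor>"
    define q :: nat where "q = 2 ^ j"
    have j: "8 \<le> j" "real j \<le> L / 2" using L by (auto simp: j_def le_nat_floor) linarith
    have "real (q * q) = 2 powr (2 * real j)"
      by (simp add: q_def powr_realpow[symmetric] flip: powr_add)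
    also have "\<dots> \<le> real n" using j by (simp add: n_L)
    finally have qn: "q * q \<le> n" by (simp only: of_nat_le_iff)
    obtain p where p: "3 \<le> p" "j \<le> 2 ^ (p - 2)"
      "L / (20 * log 2 L) * L \<le> real (j - 1 + (\<Sum>i<j div p. p - 1 + p * i))"
      using exponent_bound[OF L j_def] .
    define e where "e = j - 1 + (\<Sum>i<j div p. p - 1 + p * i)"
    have "p * (j div p) \<le> j" by simp
    then obtain \<chi> where \<chi>: "avoids q (2 ^ (p * (j div p))) (2 ^ e) \<chi>"
      using ex_avoids[of j p "j div p"] j p by (auto simp: q_def e_def)
    have "2 ^ (p * (j div p)) \<le> q"
      unfolding q_def by (intro power_increasing) auto
    then have "2 ^ e \<le> oriented_ramsey k (path_matching n (block_swap q))" if "2 \<le> k" for k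
      using oriented_ramsey_block_swap[OF \<chi> _ qn that] by simp
    then have "2 powr e \<le> oriented_ramsey k (path_matching n (block_swap q))" if "2 \<le> k" for k
      using that by (simp add: powr_realpow)
    moreover have "real n powr (L / (20 * log 2 L)) \<le> 2 powr e"
      using p(3) by (simp add: bound_eq e_def)
    ultimately have "\<forall>k\<ge>2. real n powr (L / (20 * log 2 L)) \<le> oriented_ramsey k (path_matching n (block_swap q))"
      by (meson order_trans)
    \<comment> \<open>Vertex 1 is entry 1 of block 0 and is matched to \<open>q\<close>, the first
      vertex of block 1.\<close>
    moreover have "\<exists>w>0. Suc w < block_swap q w \<and> block_swap q w < n"
    proof -
      have "2 ^ 2 \<le> q" unfolding q_def using j by (intro power_increasing) auto
      then have "4 \<le> q" by simp
      then have "block_swap q 1 = q" using block_swap[of 0 q 1] by simp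
      moreover have "4 * q \<le> n" using mult_right_mono[OF \<open>4 \<le> q\<close>, of q] qn by linarith
      ultimately show ?thesis using \<open>4 \<le> q\<close> by (intro exI[of _ 1]) auto
    qed
    ultimately show ?thesis using block_swap_block_swap by blast
  qed
  then obtain \<sigma> w where "\<And>x. \<sigma> (\<sigma> x) = x" "0 < w" "Suc w < \<sigma> w" "\<sigma> w < n"
    "\<forall>k\<ge>2. real n powr (L / (20 * log 2 L)) \<le> oriented_ramsey k (path_matching n \<sigma>)"
    by blast
  then show ?thesis
    unfolding L_def[symmetric]
    by (intro exI[of _ "path_matching n \<sigma>"])
       (simp add: oriented_digraph_path_matching acyclic_path_matching max_degree_path_matching[of \<sigma> w n])
qed

end
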